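(* Let $a,b,c\in\mathbb{R}$ and $\lambda>0$, let $P(X)=X^3-aX^2-bX-c$, with discriminant $\mathrm{Disc}(P)=a^2b^2+4b^3-4a^3c-18abc-27c^2$, and let $(X_n)_{n\ge0}$ be the Markov chain on $\mathbb{N}^3$ associated with the discrete-time Hawkes process with memory $3$ and parameters $a,b,c,\lambda$. Suppose $b<0$, $c<0$ and $\mathrm{Disc}(P)<0$. Then $(X_n)_{n\ge 0}$ is a geometrically ergodic Markov chain.
   Context: $\mathbb{N}=\{0,1,2,\dots\}$ and $(x)_+=\max(0,x)$. $\mathcal{P}(\rho)$ denotes the Poisson distribution with parameter $\rho\ge 0$ (with $\mathcal{P}(0)$ the Dirac mass at $0$). The discrete-time Hawkes process with memory $3$ and parameters $a,b,c\in\mathbb{R}$, $\lambda>0$ is the $\mathbb{N}$-valued process $(\tilde X_n)_{n\ge -2}$ such that, for all $n\ge 1$, conditionally on the past, $\tilde X_n\sim\mathcal{P}\big((a\tilde X_{n-1}+b\tilde X_{n-2}+c\tilde X_{n-3}+\lambda)_+\big)$. The associated Markov chain is $X_n=(\tilde X_n,\tilde X_{n-1},\tilde X_{n-2})\in\mathbb{N}^3$. Its transition probability from $(i,j,k)$ to $(\ell,i,j)$ is $e^{-s_{ijk}}s_{ijk}^{\ell}/\ell!$ for $\ell\in\mathbb{N}$, where $s_{ijk}=(ai+bj+ck+\lambda)_+$ (with the convention $0^0=1$); all other transition probabilities are $0$. The chain is called geometrically ergodic if it admits a stationary probability distribution $\pi$ and the law of $X_n$ converges exponentially fast in total variation to $\pi$,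 i.e. there is $\rho\in(0,1)$ and, for every initial state $x$, a constant $C_x<\infty$ such that the total variation distance between the law of $X_n$ started from $x$ and $\pi$ is at most $C_x\rho^n$ for all $n\ge0$. *)

theory Defs
  imports "HOL-Probability.Probability" "HOL-Computational_Algebra.Polynomial"
begin

section \<open>Geometric ergodicity of a Markov chain on a discrete state space\<close>

text \<open>A Markov chain is given by its transition kernel \<open>K\<close>; \<open>chain_law K x n\<close> is the law of
  the chain at time \<open>n\<close> when started from \<open>x\<close>.\<close>

primrec chain_law :: "('s \<Rightarrow> 's pmf) \<Rightarrow> 's \<Rightarrow> nat \<Rightarrow> 's pmf" where
  "chain_law K x 0 = return_pmf x"
| "chain_law K x (Suc n) = bind_pmf (chain_law K x n) K"

definition stationary :: "('s \<Rightarrow> 's pmf) \<Rightarrow> 's pmf \<Rightarrow> bool" where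
  "stationary K \<pi> \<longleftrightarrow> bind_pmf \<pi> K = \<pi>"

definition tv_dist :: "'s pmf \<Rightarrow> 's pmf \<Rightarrow> real" where
  "tv_dist p q = (SUP A. \<bar>measure_pmf.prob p A - measure_pmf.prob q A\<bar>)"

text \<open>The supremum above is over a bounded set of reals, so it is a genuine one.\<close>

lemma tv_dist_bdd: "bdd_above (range (\<lambda>A. \<bar>measure_pmf.prob p A - measure_pmf.prob q A\<bar>))"
proof (rule bdd_aboveI2)
  fix A
  show "\<bar>measure_pmf.prob p A - measure_pmf.prob q A\<bar> \<le> 1"
    using measure_pmf.prob_le_1[of p A] measure_pmf.prob_le_1[of q A]
      measure_nonneg[of "measure_pmf p" A] measure_nonneg[of "measure_pmf q" A]
    by linarith
qed

definition geometrically_ergodic :: "('s \<Rightarrow> 's pmf) \<Rightarrow> bool" where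
  "geometrically_ergodic K \<longleftrightarrow>
     (\<exists>\<pi>. stationary K \<pi> \<and>
       (\<exists>\<rho>. 0 < \<rho> \<and> \<rho> < 1 \<and>
         (\<forall>x. \<exists>C. \<forall>n. tv_dist (chain_law K x n) \<pi> \<le> C * \<rho> ^ n)))"

section \<open>The discrete-time Hawkes process with memory 3\<close>

text \<open>The library's \<open>poisson_pmf\<close> is only specified for positive rates.\<close>

definition poisson0_pmf :: "real \<Rightarrow> nat pmf" where
  "poisson0_pmf r = (if r = 0 then return_pmf 0 else poisson_pmf r)"

lemma pmf_poisson0: "r \<ge> 0 \<Longrightarrow> pmf (poisson0_pmf r) l = exp (- r) * r ^ l / fact l"
  by (cases l) (auto simp: poisson0_pmf_def)

definition hawkes_rate :: "real \<Rightarrow> real \<Rightarrow> real \<Rightarrow> real \<Rightarrow> nat \<times> nat \<times> nat \<Rightarrow> real" where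
  "hawkes_rate a b c lam = (\<lambda>(i, j, k). max 0 (a * real i + b * real j + c * real k + lam))"

text \<open>A state \<open>(i, j, k)\<close> lists the last three values of the process, the most recent first.\<close>

definition hawkes_kernel ::
    "real \<Rightarrow> real \<Rightarrow> real \<Rightarrow> real \<Rightarrow> nat \<times> nat \<times> nat \<Rightarrow> (nat \<times> nat \<times> nat) pmf" where
  "hawkes_kernel a b c lam = (\<lambda>(i, j, k).
     map_pmf (\<lambda>l. (l, i, j)) (poisson0_pmf (hawkes_rate a b c lam (i, j, k))))"

lemma pmf_hawkes_kernel:
  "pmf (hawkes_kernel a b c lam (i, j, k)) (l, i', j') =
     (if i' = i \<and> j' = j
      then exp (- hawkes_rate a b c lam (i, j, k)) * hawkes_rate a b c lam (i, j, k) ^ l / fact l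
      else 0)"
proof (cases "i' = i \<and> j' = j")
  case True
  have "inj (\<lambda>l::nat. (l, i, j))" by (auto simp: inj_on_def)
  moreover have "hawkes_rate a b c lam (i, j, k) \<ge> 0" by (simp add: hawkes_rate_def)
  ultimately show ?thesis
    using True pmf_map_inj'[of "\<lambda>l. (l, i, j)" _ l]
    by (simp add: hawkes_kernel_def pmf_poisson0)
next
  case False
  then have "(l, i', j') \<notin> set_pmf (hawkes_kernel a b c lam (i, j, k))"
    by (auto simp: hawkes_kernel_def)
  then show ?thesis using False by (simp add: set_pmf_iff if_not_P del: de_Morgan_conj)
qed

section \<open>The characteristic polynomial and its discriminant\<close>

definition hawkes_poly :: "real \<Rightarrow> real \<Rightarrow> real \<Rightarrow> real poly" where
  "hawkes_poly a b c = [:- c, - b, - a, 1:]"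

lemma hawkes_poly_eval: "poly (hawkes_poly a b c) x = x ^ 3 - a * x ^ 2 - b * x - c"
  by (simp add: hawkes_poly_def power2_eq_square power3_eq_cube algebra_simps)

text \<open>The discriminant of a polynomial of degree 3, in terms of its coefficients.\<close>

definition cubic_disc :: "'a :: comm_ring_1 poly \<Rightarrow> 'a" where
  "cubic_disc p = (let u = coeff p 3; v = coeff p 2; w = coeff p 1; z = coeff p 0 in
     v ^ 2 * w ^ 2 - 4 * u * w ^ 3 - 4 * v ^ 3 * z + 18 * u * v * w * z - 27 * u ^ 2 * z ^ 2)"

lemma cubic_disc_roots:
  fixes x y z :: "'a :: comm_ring_1"
  shows "cubic_disc ([:- x, 1:] * [:- y, 1:] * [:- z, 1:]) = ((x - y) * (y - z) * (x - z)) ^ 2"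
  by (simp add: cubic_disc_def Let_def numeral_eq_Suc algebra_simps)

lemma cubic_disc_hawkes_poly:
  "cubic_disc (hawkes_poly a b c) =
     a ^ 2 * b ^ 2 + 4 * b ^ 3 - 4 * a ^ 3 * c - 18 * a * b * c - 27 * c ^ 2"
  by (simp add: cubic_disc_def hawkes_poly_def Let_def numeral_eq_Suc)

end

(* Scaling out the Poisson noise and lambda, the chain follows the positively homogeneous map
   T (i, j, k) = (max 0 (a i + b j + c k), i, j). A negative discriminant together with P(0) = -c > 0
   forces P > 0 on [0, infinity), because P always has a negative root. Along an orbit of T, if kappa
   bounds the ratios of consecutive entries then, b and c being negative, the next ratio is at most
   a + b/kappa + c/kappa^2 = kappa - P(kappa)/kappa^2, which lies below kappa by a fixed amount.
   So T is nilpotent on the nonnegative cone, and V x = (SUM n<m. 2^n |T^n x|) is a Lipschitz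
   function with V (T x) <= V x / 2. Since the Poisson noise is of the order of the square root of the
   rate, V is a Lyapunov function of the chain. From {V <= R} the chain is at (0, 0, 0) three steps
   later with probability bounded below, and Harris' theorem (proved by coupling: a suitably weighted
   probability that two copies have not yet met contracts) concludes. *)

theory Submission
  imports Defs
begin

section \<open>Harris' theorem for discrete chains\<close>

text \<open>Off the diagonal the draws are independent, on it a single draw is shared: copies that
  have met stay together.\<close>

definition couple :: "('s \<Rightarrow> 't pmf) \<Rightarrow> 's \<times> 's \<Rightarrow> ('t \<times> 't) pmf" where
  "couple f z = (if fst z = snd z then map_pmf (\<lambda>u. (u, u)) (f (fst z))
     else pair_pmf (f (fst z)) (f (snd z)))"

text \<open>A weighted discrete distance. For nonnegative \<open>\<beta>\<close> and
  \<open>V\<close> it is at least 1 off the diagonal, so its mean bounds the probability of not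
  having met. Drift shrinks the \<open>V\<close> part, meeting shrinks the constant part.\<close>

definition pair_weight :: "real \<Rightarrow> ('s \<Rightarrow> real) \<Rightarrow> 's \<times> 's \<Rightarrow> real" where
  "pair_weight \<beta> V z = (if fst z = snd z then 0 else 1 + \<beta> * (V (fst z) + V (snd z)))"

lemma map_fst_couple: "map_pmf fst (couple f z) = f (fst z)"
  and map_snd_couple: "map_pmf snd (couple f z) = f (snd z)"
  by (simp_all add: couple_def map_pmf_comp map_fst_pair_pmf map_snd_pair_pmf)

lemma map_fst_bind_couple: "map_pmf fst (bind_pmf r (couple f)) = bind_pmf (map_pmf fst r) f"
  and map_snd_bind_couple: "map_pmf snd (bind_pmf r (couple f)) = bind_pmf (map_pmf snd r) f"
  by (simp_all add: map_bind_pmf bind_map_pmf map_fst_couple map_snd_couple)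

lemma map_fst_chain_couple: "map_pmf fst (chain_law (couple K) z n) = chain_law K (fst z) n"
  and map_snd_chain_couple: "map_pmf snd (chain_law (couple K) z n) = chain_law K (snd z) n"
  by (induction n) (simp_all add: map_fst_bind_couple map_snd_bind_couple)

text \<open>The coupling inequality: the two marginal events can differ only where the coordinates
  differ.\<close>

lemma coupling_bound:
  "\<bar>measure_pmf.prob (map_pmf fst r) A - measure_pmf.prob (map_pmf snd r) A\<bar>
     \<le> measure_pmf.prob r {z. fst z \<noteq> snd z}"
proof -
  let ?D = "{z. fst z \<noteq> snd z}"
  have "measure_pmf.prob r (fst -` A) \<le> measure_pmf.prob r ((snd -` A) \<union> ?D)"
    by (rule measure_pmf.finite_measure_mono) auto
  moreover have "measure_pmf.prob r (snd -` A) \<le> measure_pmf.prob r ((fst -` A) \<union> ?D)"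
    by (rule measure_pmf.finite_measure_mono) auto
  moreover have "measure_pmf.prob r (X \<union> ?D) \<le> measure_pmf.prob r X + measure_pmf.prob r ?D" for X
    by (rule measure_Un_le) auto
  ultimately show ?thesis
    by (smt (verit, best) measure_map_pmf)
qed

lemma emeasure_couple_neq_le:
  "emeasure (couple f z) {z. fst z \<noteq> snd z} \<le> indicator {z. fst z \<noteq> snd z} z"
  by (auto simp: couple_def indicator_def measure_pmf.emeasure_le_1)

text \<open>A coupled step never separates equal copies. This disposes of the steps left over after
  the last full block of \<open>N\<close>.\<close>

lemma emeasure_bind_couple_neq_le:
  "emeasure (bind_pmf r (couple f)) {z. fst z \<noteq> snd z} \<le> emeasure r {z. fst z \<noteq> snd z}"
proof -
  have "emeasure (bind_pmf r (couple f)) {z. fst z \<noteq> snd z}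
      \<le> (\<integral>\<^sup>+ z. indicator {z. fst z \<noteq> snd z} z \<partial>r)"
    by (simp del: nn_integral_indicator add: nn_integral_mono emeasure_couple_neq_le)
  then show ?thesis by simp
qed

section \<open>Iterated kernels and iterated drift\<close>

lemma chain_law_add:
  "chain_law K x (m + n) = bind_pmf (chain_law K x m) (\<lambda>y. chain_law K y n)"
  by (induction n) (simp_all add: bind_return_pmf' bind_assoc_pmf)

lemma chain_law_iterate: "chain_law (\<lambda>x. chain_law K x N) x q = chain_law K x (N * q)"
  by (induction q) (simp_all add: chain_law_add add.commute[of N])

text \<open>The constant \<open>B / (1 - \<gamma>)\<close> is the fixed point of
  \<open>u \<mapsto> \<gamma> * u + B\<close>, so the bound reproduces itself at each step.\<close>

lemma drift_iterate:
  fixes V :: "'s \<Rightarrow> real" and K :: "'s \<Rightarrow> 's pmf"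
  assumes V: "\<And>x. V x \<ge> 0" and g: "0 \<le> \<gamma>" "\<gamma> < 1" and B: "B \<ge> 0"
    and drift: "\<And>x. (\<integral>\<^sup>+ y. V y \<partial>K x) \<le> ennreal (\<gamma> * V x + B)"
  shows "(\<integral>\<^sup>+ y. V y \<partial>chain_law K x n) \<le> ennreal (\<gamma> ^ n * V x + B / (1 - \<gamma>))"
proof (induction n)
  case 0
  then show ?case using V g B by (auto intro!: ennreal_leI)
next
  case (Suc n)
  have "(\<integral>\<^sup>+ y. V y \<partial>chain_law K x (Suc n)) \<le> (\<integral>\<^sup>+ y. ennreal (\<gamma> * V y + B) \<partial>chain_law K x n)"
    by (simp add: nn_integral_mono drift)
  also have "\<dots> = (\<integral>\<^sup>+ y. ennreal \<gamma> * ennreal (V y) + ennreal B \<partial>chain_law K x n)"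
    using V g B by (simp add: ennreal_plus ennreal_mult)
  also have "\<dots> = ennreal \<gamma> * (\<integral>\<^sup>+ y. V y \<partial>chain_law K x n) + ennreal B"
    by (simp add: nn_integral_add nn_integral_cmult measure_pmf.emeasure_space_1)
  also have "\<dots> \<le> ennreal \<gamma> * ennreal (\<gamma> ^ n * V x + B / (1 - \<gamma>)) + ennreal B"
    by (intro add_mono mult_left_mono Suc) auto
  also have "\<dots> = ennreal (\<gamma> * (\<gamma> ^ n * V x + B / (1 - \<gamma>)) + B)"
    using V g B by (simp add: ennreal_plus ennreal_mult)
  also have "\<gamma> * (\<gamma> ^ n * V x + B / (1 - \<gamma>)) + B = \<gamma> ^ Suc n * V x + B / (1 - \<gamma>)"
    using g by (simp add: field_simps)
  finally show ?case .
qed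

section \<open>Contraction of the weighted distance\<close>

text \<open>Independent draws agree at least when both equal \<open>u\<close>.\<close>

lemma pair_pmf_neq_le:
  "emeasure (pair_pmf p q) {z. fst z \<noteq> snd z} \<le> ennreal (1 - pmf p u * pmf q u)"
proof -
  have "pmf (pair_pmf p q) (u, u) \<le> measure_pmf.prob (pair_pmf p q) {z. fst z = snd z}"
    by (subst measure_pmf_single[symmetric]) (intro measure_pmf.finite_measure_mono; simp)
  moreover have "measure_pmf.prob (pair_pmf p q) {z. fst z \<noteq> snd z}
      = 1 - measure_pmf.prob (pair_pmf p q) {z. fst z = snd z}"
    using measure_pmf.prob_compl[of "{z. fst z = snd z}" "pair_pmf p q"]
    by (simp add: Compl_eq_Diff_UNIV[symmetric] Collect_neg_eq)
  ultimately show ?thesis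
    by (simp add: measure_pmf.emeasure_eq_measure pmf_pair ennreal_leI)
qed

text \<open>Two regimes for a pair off the diagonal. If \<open>V x + V y\<close> is large, the drift
  alone contracts; otherwise both points lie in a sublevel set of \<open>V\<close>, and the copies
  meet at \<open>z\<^sub>0\<close> with probability at least \<open>\<alpha> ^ 2\<close>.\<close>

lemma couple_contraction:
  fixes V :: "'s \<Rightarrow> real" and Q :: "'s \<Rightarrow> 's pmf" and z\<^sub>0 :: 's
  assumes V: "\<And>x. V x \<ge> 0" and g: "0 \<le> \<gamma>" "\<gamma> < 1" and B: "B \<ge> 0"
    and drift: "\<And>x. (\<integral>\<^sup>+ y. V y \<partial>Q x) \<le> ennreal (\<gamma> * V x + B)"
    and minor: "\<And>R. \<exists>\<alpha>>0. \<forall>x. V x \<le> R \<longrightarrow> \<alpha> \<le> pmf (Q x) z\<^sub>0"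
  shows "\<exists>\<beta>>0. \<exists>\<rho>. 0 < \<rho> \<and> \<rho> < 1 \<and>
    (\<forall>z. (\<integral>\<^sup>+ w. pair_weight \<beta> V w \<partial>couple Q z) \<le> ennreal (\<rho> * pair_weight \<beta> V z))"
proof -
  \<comment> \<open>Chosen so that \<open>(1 - \<gamma>) / 2 * R = 2 * B + 1\<close>: beyond
    \<open>R\<close> the spare contraction pays for both drift constants and for
    \<open>1 - \<rho> \<le> \<beta>\<close>.\<close>
  define R where "R = 2 * (2 * B + 1) / (1 - \<gamma>)"
  obtain \<alpha> where \<alpha>: "\<alpha> > 0" "\<And>x. V x \<le> R \<Longrightarrow> \<alpha> \<le> pmf (Q x) z\<^sub>0"
    using minor by blast
  define a where "a = \<alpha> ^ 2"
  \<comment> \<open>Small enough that in the near regime the gain \<open>a\<close> covers the drift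
    term \<open>2 * \<beta> * B\<close> together with the loss
    \<open>1 - \<rho> \<le> \<beta>\<close>.\<close>
  define \<beta> where "\<beta> = a / (4 * B + 4)"
  \<comment> \<open>The first bound leaves \<open>\<rho> - \<gamma> \<ge> (1 - \<gamma>) / 2\<close>
    for the far regime, the second gives \<open>1 - \<rho> \<le> \<beta>\<close>.\<close>
  define \<rho> where "\<rho> = max ((1 + \<gamma>) / 2) (1 - \<beta>)"
  have a: "a > 0" using \<alpha> by (simp add: a_def)
  have \<beta>: "\<beta> > 0" using a B by (simp add: \<beta>_def)
  have \<rho>: "0 < \<rho>" "\<rho> < 1" "\<rho> \<ge> (1 + \<gamma>) / 2" "\<rho> \<ge> 1 - \<beta>" using \<beta> g by (auto simp: \<rho>_def less_max_iff_disj)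
  have "\<beta> * (4 * B + 4) = a" using B by (simp add: \<beta>_def)
  then have ab: "4 * \<beta> * B + 4 * \<beta> = a" by (simp add: algebra_simps)
  have "(\<integral>\<^sup>+ w. pair_weight \<beta> V w \<partial>couple Q z) \<le> ennreal (\<rho> * pair_weight \<beta> V z)" for z
  proof (cases "fst z = snd z")
    case True
    then show ?thesis by (simp add: couple_def pair_weight_def)
  next
    case False
    define x y where "x = fst z" and "y = snd z"
    define S where "S = V x + V y"
    define e where "e = 1 - pmf (Q x) z\<^sub>0 * pmf (Q y) z\<^sub>0"
    have e: "0 \<le> e" "e \<le> 1"
      using mult_mono[OF pmf_le_1[of "Q x" z\<^sub>0] pmf_le_1[of "Q y" z\<^sub>0]] by (auto simp: e_def)
    have S: "S \<ge> 0" using V by (simp add: S_def)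
    have "(\<integral>\<^sup>+ w. pair_weight \<beta> V w \<partial>couple Q z) = (\<integral>\<^sup>+ w. pair_weight \<beta> V w \<partial>pair_pmf (Q x) (Q y))"
      using False by (simp add: couple_def x_def y_def)
    \<comment> \<open>Keeping the \<open>V\<close> part on the diagonal as well makes it a sum of
      functions of the marginals.\<close>
    also have "\<dots> \<le> (\<integral>\<^sup>+ w. indicator {z. fst z \<noteq> snd z} w
        + ennreal \<beta> * (ennreal (V (fst w)) + ennreal (V (snd w))) \<partial>pair_pmf (Q x) (Q y))"
      using V \<beta> by (intro nn_integral_mono)
        (auto simp: pair_weight_def ennreal_plus ennreal_mult add_nonneg_nonneg indicator_def)
    also have "\<dots> = emeasure (pair_pmf (Q x) (Q y)) {z. fst z \<noteq> snd z}
        + ennreal \<beta> * ((\<integral>\<^sup>+ w. V (fst w) \<partial>pair_pmf (Q x) (Q y)) + (\<integral>\<^sup>+ w. V (snd w) \<partial>pair_pmf (Q x) (Q y)))"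
      by (simp add: nn_integral_add nn_integral_cmult)
    also have "\<dots> = emeasure (pair_pmf (Q x) (Q y)) {z. fst z \<noteq> snd z}
        + ennreal \<beta> * ((\<integral>\<^sup>+ u. V u \<partial>Q x) + (\<integral>\<^sup>+ u. V u \<partial>Q y))"
      by (simp add: nn_integral_pair_pmf' measure_pmf.emeasure_space_1)
    also have "\<dots> \<le> ennreal e + ennreal \<beta> * (ennreal (\<gamma> * V x + B) + ennreal (\<gamma> * V y + B))"
      unfolding e_def by (intro add_mono mult_left_mono pair_pmf_neq_le drift) auto
    also have "\<dots> = ennreal (e + \<beta> * (\<gamma> * S + 2 * B))"
      using e \<beta> B g V by (simp add: S_def flip: ennreal_plus ennreal_mult) (simp add: algebra_simps)
    also have "\<dots> \<le> ennreal (\<rho> * (1 + \<beta> * S))"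
    proof (rule ennreal_leI, cases "S \<ge> R")
      case True
      have "(1 - \<gamma>) * R = 2 * (2 * B + 1)" using g by (simp add: R_def)
      then have "2 * B + 1 = (1 - \<gamma>) / 2 * R" by simp
      also have "\<dots> \<le> (\<rho> - \<gamma>) * S" using \<rho> g True B by (intro mult_mono) (auto simp: R_def field_simps)
      finally have "\<beta> * (2 * B + 1) \<le> \<beta> * ((\<rho> - \<gamma>) * S)" using \<beta> by simp
      then show "e + \<beta> * (\<gamma> * S + 2 * B) \<le> \<rho> * (1 + \<beta> * S)"
        using e \<rho> by (simp add: algebra_simps)
    next
      case False
      then have "V x \<le> R" "V y \<le> R" using V[of x] V[of y] by (auto simp: S_def)
      then have "a \<le> pmf (Q x) z\<^sub>0 * pmf (Q y) z\<^sub>0"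
        unfolding a_def power2_eq_square using \<alpha> by (intro mult_mono) (auto intro: order.trans[OF less_imp_le])
      then have "e \<le> 1 - a" by (simp add: e_def)
      moreover have "\<beta> * (\<gamma> * S) \<le> \<beta> * (\<rho> * S)"
        using \<rho> g S \<beta> by (intro mult_left_mono mult_right_mono) auto
      moreover have "\<beta> * B \<ge> 0" using \<beta> B by simp
      ultimately show "e + \<beta> * (\<gamma> * S + 2 * B) \<le> \<rho> * (1 + \<beta> * S)"
        using \<rho> ab \<beta> by (simp add: algebra_simps)
    qed
    also have "\<rho> * (1 + \<beta> * S) = \<rho> * pair_weight \<beta> V z"
      using False by (simp add: pair_weight_def S_def x_def y_def)
    finally show ?thesis .
  qed
  then show ?thesis using \<beta> \<rho> by blast
qed

lemma couple_decay:
  fixes V :: "'s \<Rightarrow> real" and Q :: "'s \<Rightarrow> 's pmf"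
  assumes "\<beta> \<ge> 0" "\<And>x. V x \<ge> 0" "\<rho> \<ge> 0"
    and contr: "\<And>z. (\<integral>\<^sup>+ w. pair_weight \<beta> V w \<partial>couple Q z) \<le> ennreal (\<rho> * pair_weight \<beta> V z)"
  shows "(\<integral>\<^sup>+ w. pair_weight \<beta> V w \<partial>chain_law (couple Q) z q) \<le> ennreal (\<rho> ^ q * pair_weight \<beta> V z)"
proof (induction q)
  case (Suc q)
  have nn: "pair_weight \<beta> V w \<ge> 0" for w
    using assms(1,2) by (simp add: pair_weight_def)
  have "(\<integral>\<^sup>+ w. pair_weight \<beta> V w \<partial>chain_law (couple Q) z (Suc q))
      \<le> (\<integral>\<^sup>+ w. ennreal \<rho> * ennreal (pair_weight \<beta> V w) \<partial>chain_law (couple Q) z q)"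
    using contr nn assms(3) by (simp add: nn_integral_mono flip: ennreal_mult)
  also have "\<dots> \<le> ennreal \<rho> * ennreal (\<rho> ^ q * pair_weight \<beta> V z)"
    by (simp add: nn_integral_cmult mult_left_mono Suc)
  finally show ?case using nn assms(3) by (simp add: mult.assoc flip: ennreal_mult)
qed simp

text \<open>Time \<open>n\<close> is split into full blocks of \<open>N\<close> steps, each
  contracting the weight, and a remainder that does not separate the copies. A point mass as
  \<open>\<mu>\<close> compares two starting points; the law at an earlier time compares two
  times.\<close>

lemma chain_law_close:
  fixes V :: "'s \<Rightarrow> real" and K :: "'s \<Rightarrow> 's pmf" and \<mu> :: "'s pmf"
  assumes "\<beta> \<ge> 0" "\<And>x. V x \<ge> 0" "\<rho> \<ge> 0"
    and contr: "\<And>z. (\<integral>\<^sup>+ w. pair_weight \<beta> V w \<partial>couple (\<lambda>x. chain_law K x N) z)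
                 \<le> ennreal (\<rho> * pair_weight \<beta> V z)"
    and M: "(\<integral>\<^sup>+ y. pair_weight \<beta> V (x, y) \<partial>\<mu>) \<le> ennreal M" and "M \<ge> 0"
  shows "\<bar>measure_pmf.prob (chain_law K x n) A
     - measure_pmf.prob (bind_pmf \<mu> (\<lambda>y. chain_law K y n)) A\<bar> \<le> \<rho> ^ (n div N) * M"
proof -
  let ?Q = "\<lambda>x. chain_law K x N" and ?D = "{z. fst z \<noteq> snd z}"
  define q r where "q = n div N" and "r = n mod N"
  have n: "n = N * q + r" by (simp add: q_def r_def)
  \<comment> \<open>One copy starts at \<open>x\<close>, the other at a random point of law
    \<open>\<mu>\<close>; \<open>c\<close> runs the \<open>q\<close> blocks and \<open>d\<close> the
    \<open>r\<close> remaining steps.\<close>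
  define c where "c = bind_pmf \<mu> (\<lambda>y. chain_law (couple ?Q) (x, y) q)"
  define d where "d = bind_pmf c (couple (\<lambda>y. chain_law K y r))"
  have fst_c: "map_pmf fst c = chain_law K x (N * q)"
    by (simp add: c_def map_bind_pmf map_fst_chain_couple chain_law_iterate)
  have snd_c: "map_pmf snd c = bind_pmf \<mu> (\<lambda>y. chain_law K y (N * q))"
    by (simp add: c_def map_bind_pmf map_snd_chain_couple chain_law_iterate)
  have fst_d: "map_pmf fst d = chain_law K x n"
    by (simp add: d_def map_fst_bind_couple fst_c n chain_law_add)
  have snd_d: "map_pmf snd d = bind_pmf \<mu> (\<lambda>y. chain_law K y n)"
    by (simp add: d_def map_snd_bind_couple snd_c n chain_law_add bind_assoc_pmf)
  have "emeasure d ?D \<le> emeasure c ?D"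
    unfolding d_def by (rule emeasure_bind_couple_neq_le)
  also have "\<dots> = (\<integral>\<^sup>+ y. emeasure (chain_law (couple ?Q) (x, y) q) ?D \<partial>\<mu>)"
    by (simp add: c_def)
  also have "\<dots> \<le> (\<integral>\<^sup>+ y. ennreal (\<rho> ^ q) * ennreal (pair_weight \<beta> V (x, y)) \<partial>\<mu>)"
  proof (rule nn_integral_mono)
    fix y
    have "emeasure (chain_law (couple ?Q) (x, y) q) ?D
        = (\<integral>\<^sup>+ w. indicator ?D w \<partial>chain_law (couple ?Q) (x, y) q)" by simp
    also have "\<dots> \<le> (\<integral>\<^sup>+ w. pair_weight \<beta> V w \<partial>chain_law (couple ?Q) (x, y) q)"
      using assms(1,2) by (intro nn_integral_mono) (auto simp: indicator_def pair_weight_def)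
    also have "\<dots> \<le> ennreal (\<rho> ^ q * pair_weight \<beta> V (x, y))"
      by (rule couple_decay[OF assms(1-3) contr])
    also have "\<dots> = ennreal (\<rho> ^ q) * ennreal (pair_weight \<beta> V (x, y))"
      using assms(1-3) by (intro ennreal_mult) (auto simp: pair_weight_def)
    finally show "emeasure (chain_law (couple ?Q) (x, y) q) ?D
        \<le> ennreal (\<rho> ^ q) * ennreal (pair_weight \<beta> V (x, y))" .
  qed
  also have "\<dots> \<le> ennreal (\<rho> ^ q) * ennreal M"
    by (simp add: nn_integral_cmult mult_left_mono M)
  also have "\<dots> = ennreal (\<rho> ^ q * M)" using assms(3,6) by (simp add: ennreal_mult)
  finally have "measure_pmf.prob d ?D \<le> \<rho> ^ q * M"
    using assms(3,6) by (simp add: measure_pmf.emeasure_eq_measure)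
  then show ?thesis using coupling_bound[of d A] by (simp add: fst_d snd_d q_def)
qed

section \<open>Limits of probability mass functions\<close>

text \<open>Pointwise limits pass directly only to finite sets; this carries estimates from there to
  arbitrary sets.\<close>

lemma prob_finite_approx:
  assumes "\<delta> > 0"
  obtains F where "finite F" "F \<subseteq> A" "measure_pmf.prob p A - measure_pmf.prob p F \<le> \<delta>"
proof -
  have "Infinite_Sum.abs_summable_on (pmf p) A"
    by (rule iffD2[OF abs_summable_equivalent pmf_abs_summable])
  from has_sum_infsum[OF abs_summable_summable[OF this]]
  have "(pmf p has_sum measure_pmf.prob p A) A"
    using infsetsum_infsum[OF pmf_abs_summable[of p A]]
    by (simp add: measure_pmf_conv_infsetsum)
  from has_sum_finite_approximation[OF this assms]
  obtain F where F: "finite F" "F \<subseteq> A" "dist (sum (pmf p) F) (measure_pmf.prob p A) \<le> \<delta>" by blast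
  then show ?thesis
    by (intro that[of F]) (auto simp: dist_real_def measure_measure_pmf_finite)
qed

text \<open>Completeness in total variation, keeping the rate. The pointwise limit has mass at most
  1 by Fatou, and uniform closeness on finite sets prevents mass from escaping.\<close>

lemma pmf_limit:
  fixes p :: "nat \<Rightarrow> 's pmf"
  assumes e0: "e \<longlonglongrightarrow> (0::real)"
    and e: "\<And>n m A. n \<le> m \<Longrightarrow> \<bar>measure_pmf.prob (p n) A - measure_pmf.prob (p m) A\<bar> \<le> e n"
  shows "\<exists>q. \<forall>n A. \<bar>measure_pmf.prob (p n) A - measure_pmf.prob q A\<bar> \<le> e n"
proof -
  have "convergent (\<lambda>n. pmf (p n) z)" for z
  proof (rule Cauchy_convergent, rule metric_CauchyI)
    fix \<epsilon> :: real assume "\<epsilon> > 0"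
    then obtain n0 where n0: "\<And>n. n \<ge> n0 \<Longrightarrow> e n < \<epsilon>"
      using order_tendstoD(2)[OF e0] unfolding eventually_sequentially by blast
    have "\<bar>pmf (p m) z - pmf (p n) z\<bar> < \<epsilon>" if "m \<ge> n0" "n \<ge> n0" for m n
      using e[of m n "{z}"] e[of n m "{z}"] n0[OF that(1)] n0[OF that(2)]
      by (cases "m \<le> n") (auto simp: measure_pmf_single)
    then show "\<exists>M. \<forall>m\<ge>M. \<forall>n\<ge>M. dist (pmf (p m) z) (pmf (p n) z) < \<epsilon>"
      by (auto simp: dist_real_def)
  qed
  then obtain f where f: "\<And>z. (\<lambda>n. pmf (p n) z) \<longlonglongrightarrow> f z"
    unfolding convergent_def by metis
  have f0: "f z \<ge> 0" for z
    by (rule LIMSEQ_le_const[OF f]) auto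
  have lim_finite: "(\<lambda>m. measure_pmf.prob (p m) F) \<longlonglongrightarrow> sum f F" if "finite F" for F
    using that by (simp add: measure_measure_pmf_finite f tendsto_sum)
  have close: "\<bar>measure_pmf.prob (p n) F - sum f F\<bar> \<le> e n" if "finite F" for n F
    by (rule LIMSEQ_le_const2[OF tendsto_rabs[OF tendsto_diff[OF tendsto_const lim_finite[OF that]]]])
      (use e in auto)
  have "(\<integral>\<^sup>+ z. f z \<partial>count_space UNIV) = (\<integral>\<^sup>+ z. liminf (\<lambda>n. ennreal (pmf (p n) z)) \<partial>count_space UNIV)"
    by (intro nn_integral_cong lim_imp_Liminf[symmetric] tendsto_ennrealI f) auto
  also have "\<dots> \<le> liminf (\<lambda>n. \<integral>\<^sup>+ z. pmf (p n) z \<partial>count_space UNIV)"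
    by (rule nn_integral_liminf) auto
  also have "\<dots> = 1" by (simp add: nn_integral_pmf Liminf_const)
  finally have "(\<integral>\<^sup>+ z. f z \<partial>count_space UNIV) \<le> 1" .
  \<comment> \<open>A finite set carrying almost all of one late \<open>p n\<close> carries almost
    the same mass under \<open>f\<close>.\<close>
  moreover have "1 \<le> (\<integral>\<^sup>+ z. f z \<partial>count_space UNIV)"
  proof (rule ennreal_le_epsilon)
    fix \<epsilon> :: real assume \<epsilon>: "\<epsilon> > 0"
    then obtain n where n: "e n < \<epsilon> / 2"
      using order_tendstoD(2)[OF e0, of "\<epsilon> / 2"] unfolding eventually_sequentially by auto
    obtain F where F: "finite F" "measure_pmf.prob (p n) UNIV - measure_pmf.prob (p n) F \<le> \<epsilon> / 2"
      using prob_finite_approx[of "\<epsilon> / 2" UNIV "p n"] \<epsilon> by auto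
    have "1 \<le> sum f F + \<epsilon>" using close[OF F(1), of n] F n by simp
    then have "1 \<le> ennreal (sum f F + \<epsilon>)" by simp
    also have "\<dots> = (\<Sum>z\<in>F. ennreal (f z)) + ennreal \<epsilon>"
      using f0 \<epsilon> by (simp add: sum_nonneg ennreal_plus)
    also have "(\<Sum>z\<in>F. ennreal (f z)) = (\<integral>\<^sup>+ z. f z \<partial>count_space F)"
      using F by (simp add: nn_integral_count_space_finite)
    also have "\<dots> \<le> (\<integral>\<^sup>+ z. f z \<partial>count_space UNIV)"
      by (simp add: nn_integral_count_space_indicator[of F] nn_integral_mono indicator_def)
    finally show "1 \<le> (\<integral>\<^sup>+ z. f z \<partial>count_space UNIV) + ennreal \<epsilon>" by simp
  qed
  ultimately have one: "(\<integral>\<^sup>+ z. f z \<partial>count_space UNIV) = 1" by (rule antisym)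
  define q where "q = embed_pmf f"
  have q: "pmf q z = f z" for z unfolding q_def by (rule pmf_embed_pmf) (use f0 one in auto)
  have "\<bar>measure_pmf.prob (p n) A - measure_pmf.prob q A\<bar> \<le> e n" for n A
  proof (rule field_le_epsilon)
    fix \<epsilon> :: real assume \<epsilon>: "\<epsilon> > 0"
    obtain F where F: "finite F" "F \<subseteq> A" "measure_pmf.prob (p n) A - measure_pmf.prob (p n) F \<le> \<epsilon>"
      using prob_finite_approx[OF \<epsilon>] by metis
    obtain G where G: "finite G" "G \<subseteq> A" "measure_pmf.prob q A - measure_pmf.prob q G \<le> \<epsilon>"
      using prob_finite_approx[OF \<epsilon>] by metis
    \<comment> \<open>\<open>F \<union> G\<close> approximates \<open>A\<close> from inside for both
      measures. Both errors lie between 0 and \<open>\<epsilon>\<close>, so their difference costs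
      one \<open>\<epsilon>\<close> only.\<close>
    have "measure_pmf.prob r F \<le> measure_pmf.prob r (F \<union> G)"
      "measure_pmf.prob r G \<le> measure_pmf.prob r (F \<union> G)"
      "measure_pmf.prob r (F \<union> G) \<le> measure_pmf.prob r A" for r :: "'s pmf"
      using F G by (auto intro!: measure_pmf.finite_measure_mono)
    moreover have "\<bar>measure_pmf.prob (p n) (F \<union> G) - measure_pmf.prob q (F \<union> G)\<bar> \<le> e n"
      using close[of "F \<union> G" n] F G by (simp add: measure_measure_pmf_finite[of _ q] q)
    ultimately show "\<bar>measure_pmf.prob (p n) A - measure_pmf.prob q A\<bar> \<le> e n + \<epsilon>"
      using F(3) G(3) by (smt (verit))
  qed
  then show ?thesis by blast
qed

lemma pmf_eqI_le:
  assumes "\<And>z. pmf p z \<le> pmf q z"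
  shows "p = q"
proof (rule pmf_eqI, rule ccontr)
  have le: "measure_pmf.prob p A \<le> measure_pmf.prob q A" for A
  proof -
    have "emeasure p A \<le> emeasure q A"
      unfolding nn_integral_pmf[symmetric] using assms by (intro nn_integral_mono) (simp add: ennreal_leI)
    then show ?thesis by (simp add: measure_pmf.emeasure_eq_measure)
  qed
  fix z assume "pmf p z \<noteq> pmf q z"
  then have "measure_pmf.prob p {z} < measure_pmf.prob q {z}"
    using assms[of z] by (simp add: measure_pmf_single)
  moreover have "measure_pmf.prob p (- {z}) \<le> measure_pmf.prob q (- {z})" by (rule le)
  ultimately show False
    using measure_pmf.prob_compl[of "{z}" p] measure_pmf.prob_compl[of "{z}" q]
    by (simp add: Compl_eq_Diff_UNIV)
qed

text \<open>By Fatou, \<open>bind_pmf \<pi> K\<close> is pointwise at most \<open>\<pi>\<close>, and two probability mass functions cannot be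
  ordered without being equal.\<close>

lemma stationary_limit:
  assumes "\<And>z. (\<lambda>n. pmf (chain_law K x n) z) \<longlonglongrightarrow> pmf \<pi> z"
  shows "stationary K \<pi>"
  unfolding stationary_def
proof (rule pmf_eqI_le)
  fix z
  have "ennreal (pmf (bind_pmf \<pi> K) z)
      = (\<integral>\<^sup>+ y. liminf (\<lambda>n. ennreal (pmf (chain_law K x n) y) * ennreal (pmf (K y) z)) \<partial>count_space UNIV)"
    unfolding ennreal_pmf_bind nn_integral_measure_pmf
    by (intro nn_integral_cong lim_imp_Liminf[symmetric])
      (auto simp flip: ennreal_mult intro!: tendsto_ennrealI tendsto_mult assms)
  also have "\<dots> \<le> liminf (\<lambda>n. \<integral>\<^sup>+ y. ennreal (pmf (chain_law K x n) y) * ennreal (pmf (K y) z) \<partial>count_space UNIV)"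
    by (rule nn_integral_liminf) auto
  also have "\<dots> = liminf (\<lambda>n. ennreal (pmf (chain_law K x (Suc n)) z))"
    by (simp add: ennreal_pmf_bind nn_integral_measure_pmf)
  also have "\<dots> = ennreal (pmf \<pi> z)"
    by (intro lim_imp_Liminf tendsto_ennrealI LIMSEQ_Suc assms) auto
  finally show "pmf (bind_pmf \<pi> K) z \<le> pmf \<pi> z" by simp
qed

section \<open>From contraction to geometric ergodicity\<close>

text \<open>The \<open>N\<close>-step kernel contracts the weight. Comparing two times of the chain
  from \<open>z\<^sub>0\<close> shows that its laws are Cauchy, with a stationary limit; comparing
  \<open>x\<close> with \<open>z\<^sub>0\<close> then covers every start.\<close>

theorem harris:
  fixes V :: "'s \<Rightarrow> real" and K :: "'s \<Rightarrow> 's pmf" and z\<^sub>0 :: 's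
  assumes V: "\<And>x. V x \<ge> 0" and g: "0 \<le> \<gamma>" "\<gamma> < 1" and B: "B \<ge> 0" and N: "N > 0"
    and drift: "\<And>x. (\<integral>\<^sup>+ y. V y \<partial>K x) \<le> ennreal (\<gamma> * V x + B)"
    and minor: "\<And>R. \<exists>\<alpha>>0. \<forall>x. V x \<le> R \<longrightarrow> \<alpha> \<le> pmf (chain_law K x N) z\<^sub>0"
  shows "geometrically_ergodic K"
proof -
  define B' where "B' = B / (1 - \<gamma>)"
  have B': "B' \<ge> 0" using B g by (simp add: B'_def)
  have moment: "(\<integral>\<^sup>+ y. V y \<partial>chain_law K x n) \<le> ennreal (\<gamma> ^ n * V x + B')" for x n
    unfolding B'_def by (rule drift_iterate[OF V g B drift])
  have "\<gamma> ^ N * V x \<le> \<gamma> * V x" for x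
    using power_decreasing[of 1 N \<gamma>] N g V by (intro mult_right_mono) auto
  then have driftN: "(\<integral>\<^sup>+ y. V y \<partial>chain_law K x N) \<le> ennreal (\<gamma> * V x + B')" for x
    by (intro order.trans[OF moment] ennreal_leI) simp
  obtain \<beta> \<rho> where \<beta>: "\<beta> > 0" and \<rho>: "0 < \<rho>" "\<rho> < 1" and contr:
    "\<And>z. (\<integral>\<^sup>+ w. pair_weight \<beta> V w \<partial>couple (\<lambda>x. chain_law K x N) z) \<le> ennreal (\<rho> * pair_weight \<beta> V z)"
    using couple_contraction[OF V g B' driftN minor] by blast
  note close = chain_law_close[OF less_imp_le[OF \<beta>] V less_imp_le[OF \<rho>(1)] contr]
  \<comment> \<open>Bounds the mean weight between \<open>x\<close> and the chain from
    \<open>x\<close> at any time: one \<open>V x\<close> is the fixed point's, the other plus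
    \<open>B'\<close> bounds the moment of the chain.\<close>
  define M where "M x = 1 + \<beta> * (2 * V x + B')" for x
  have M0: "M x \<ge> 0" for x using V \<beta> B' by (simp add: M_def add_nonneg_nonneg)
  have M: "(\<integral>\<^sup>+ y. pair_weight \<beta> V (x, y) \<partial>chain_law K x m) \<le> ennreal (M x)" for x m
  proof -
    have "(\<integral>\<^sup>+ y. pair_weight \<beta> V (x, y) \<partial>chain_law K x m)
        \<le> (\<integral>\<^sup>+ y. ennreal (1 + \<beta> * V x) + ennreal \<beta> * ennreal (V y) \<partial>chain_law K x m)"
      using V \<beta> by (intro nn_integral_mono)
        (auto simp: pair_weight_def algebra_simps simp flip: ennreal_mult ennreal_plus)
    also have "\<dots> = ennreal (1 + \<beta> * V x) + ennreal \<beta> * (\<integral>\<^sup>+ y. V y \<partial>chain_law K x m)"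
      by (simp add: nn_integral_add nn_integral_cmult measure_pmf.emeasure_space_1)
    also have "\<dots> \<le> ennreal (1 + \<beta> * V x) + ennreal \<beta> * ennreal (\<gamma> ^ m * V x + B')"
      by (intro add_left_mono mult_left_mono moment) auto
    also have "\<dots> = ennreal (1 + \<beta> * V x + \<beta> * (\<gamma> ^ m * V x + B'))"
      using V \<beta> B' g by (simp flip: ennreal_mult ennreal_plus)
    also have "\<dots> \<le> ennreal (M x)"
    proof (rule ennreal_leI)
      have "\<gamma> ^ m * V x \<le> V x" using V g by (simp add: mult_left_le_one_le power_le_one)
      then have "\<beta> * (\<gamma> ^ m * V x) \<le> \<beta> * V x" using \<beta> by simp
      then show "1 + \<beta> * V x + \<beta> * (\<gamma> ^ m * V x + B') \<le> M x"
        by (simp add: M_def algebra_simps)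
    qed
    finally show ?thesis .
  qed
  \<comment> \<open>Converts the rate per block into a rate per step; the factor
    \<open>1 / \<rho>\<close> in \<open>rate\<close> pays for the incomplete last block.\<close>
  define \<sigma> where "\<sigma> = root N \<rho>"
  have \<sigma>: "0 < \<sigma>" "\<sigma> < 1" "\<sigma> ^ N = \<rho>" using \<rho> N by (auto simp: \<sigma>_def)
  have rate: "\<rho> ^ (n div N) \<le> \<sigma> ^ n / \<rho>" for n
  proof -
    have "\<rho> ^ (n div N) * \<rho> = \<sigma> ^ (N * (n div N) + N)" by (simp add: power_add power_mult \<sigma>)
    also have "\<dots> \<le> \<sigma> ^ n"
    proof (rule power_decreasing)
      show "n \<le> N * (n div N) + N"
        using mult_div_mod_eq[of N n] mod_less_divisor[OF N, of n] by linarith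
    qed (use \<sigma> in auto)
    finally show ?thesis using \<rho> by (simp add: field_simps)
  qed
  define e where "e n = \<sigma> ^ n / \<rho> * M z\<^sub>0" for n
  have "e \<longlonglongrightarrow> 0"
    unfolding e_def using tendsto_mult_right_zero[OF LIMSEQ_realpow_zero[of \<sigma>], of "M z\<^sub>0 / \<rho>"] \<sigma>
    by (simp add: field_simps)
  moreover have "\<bar>measure_pmf.prob (chain_law K z\<^sub>0 n) A - measure_pmf.prob (chain_law K z\<^sub>0 m) A\<bar> \<le> e n"
    if "n \<le> m" for n m A
  proof -
    \<comment> \<open>Time \<open>m\<close> is time \<open>n\<close> for the chain started from its
      law at time \<open>m - n\<close>, which serves as \<open>\<mu>\<close>.\<close>
    have "chain_law K z\<^sub>0 m = bind_pmf (chain_law K z\<^sub>0 (m - n)) (\<lambda>y. chain_law K y n)"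
      using that chain_law_add[of K z\<^sub>0 "m - n" n] by simp
    then have "\<bar>measure_pmf.prob (chain_law K z\<^sub>0 n) A - measure_pmf.prob (chain_law K z\<^sub>0 m) A\<bar>
        \<le> \<rho> ^ (n div N) * M z\<^sub>0"
      using close[OF M M0] by simp
    also have "\<dots> \<le> e n" unfolding e_def using M0 by (intro mult_right_mono rate)
    finally show ?thesis .
  qed
  ultimately obtain \<pi> where \<pi>:
    "\<And>n A. \<bar>measure_pmf.prob (chain_law K z\<^sub>0 n) A - measure_pmf.prob \<pi> A\<bar> \<le> e n"
    using pmf_limit[of e "chain_law K z\<^sub>0"] by blast
  have "stationary K \<pi>"
  proof (rule stationary_limit)
    fix z
    have "(\<lambda>n. pmf (chain_law K z\<^sub>0 n) z - pmf \<pi> z) \<longlonglongrightarrow> 0"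
      by (rule tendsto_rabs_zero_cancel, rule tendsto_sandwich[OF _ _ tendsto_const \<open>e \<longlonglongrightarrow> 0\<close>])
        (use \<pi>[of _ "{z}"] in \<open>auto simp: measure_pmf_single\<close>)
    then show "(\<lambda>n. pmf (chain_law K z\<^sub>0 n) z) \<longlonglongrightarrow> pmf \<pi> z" by (simp add: LIM_zero_iff)
  qed
  moreover have "\<exists>C. \<forall>n. tv_dist (chain_law K x n) \<pi> \<le> C * \<sigma> ^ n" for x
  proof (intro exI allI)
    fix n
    define U where "U = pair_weight \<beta> V (x, z\<^sub>0)"
    have U: "U \<ge> 0" using V \<beta> by (simp add: U_def pair_weight_def)
    show "tv_dist (chain_law K x n) \<pi> \<le> (U + M z\<^sub>0) / \<rho> * \<sigma> ^ n"
      unfolding tv_dist_def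
    proof (rule cSUP_least)
      fix A
      have "\<bar>measure_pmf.prob (chain_law K x n) A - measure_pmf.prob (chain_law K z\<^sub>0 n) A\<bar>
          \<le> \<rho> ^ (n div N) * U"
        using close[of "return_pmf z\<^sub>0" x U n A] U by (simp add: bind_return_pmf U_def)
      also have "\<dots> \<le> \<sigma> ^ n / \<rho> * U" using U by (intro mult_right_mono rate)
      finally show "\<bar>measure_pmf.prob (chain_law K x n) A - measure_pmf.prob \<pi> A\<bar> \<le> (U + M z\<^sub>0) / \<rho> * \<sigma> ^ n"
        using \<pi>[of n A] by (simp add: e_def algebra_simps add_divide_distrib)
    qed simp
  qed
  ultimately show ?thesis unfolding geometrically_ergodic_def using \<sigma> by blast
qed

section \<open>The noiseless dynamics\<close>

text \<open>A nonnegative root, together with the negative root that always exists, would split the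
  cubic into real linear factors and make its discriminant a square.\<close>

lemma hawkes_poly_pos:
  assumes c: "c < 0" and disc: "cubic_disc (hawkes_poly a b c) < 0" and x: "x \<ge> 0"
  shows "poly (hawkes_poly a b c) x > 0"
proof (rule ccontr)
  let ?p = "poly (hawkes_poly a b c)"
  have cont: "continuous_on S ?p" for S
    using continuous_on_poly[of S "\<lambda>x. x"] by (simp add: continuous_on_id)
  assume "\<not> ?p x > 0"
  then have "?p x \<le> 0" by simp
  moreover have p0: "?p 0 > 0" using c by (simp add: hawkes_poly_eval)
  ultimately obtain y where y: "y \<ge> 0" "?p y = 0"
    using IVT2'[of ?p x 0 0] x cont by auto
  \<comment> \<open>At \<open>- M\<close> the cubic term dominates: the other coefficients have
    absolute values summing to \<open>M - 1\<close>, which leaves at most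
    \<open>- M\<^sup>2\<close>.\<close>
  define M where "M = 1 + \<bar>a\<bar> + \<bar>b\<bar> + \<bar>c\<bar>"
  have M: "M \<ge> 1" by (simp add: M_def)
  have "?p (- M) \<le> 0"
  proof -
    have "?p (- M) = - (M * M\<^sup>2) - a * M\<^sup>2 + b * M - c"
      by (simp add: hawkes_poly_eval power3_eq_cube power2_eq_square)
    also have "\<dots> \<le> - (M * M\<^sup>2) + \<bar>a\<bar> * M\<^sup>2 + \<bar>b\<bar> * M\<^sup>2 + \<bar>c\<bar> * M\<^sup>2"
    proof -
      have "- a * M\<^sup>2 \<le> \<bar>a\<bar> * M\<^sup>2" by (intro mult_right_mono) auto
      moreover have "b * M \<le> \<bar>b\<bar> * M\<^sup>2" using M by (intro mult_mono) (auto simp: power2_eq_square)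
      moreover have "- c * 1 \<le> \<bar>c\<bar> * M\<^sup>2" using M by (intro mult_mono) (auto simp: one_le_power)
      ultimately show ?thesis by simp
    qed
    also have "\<dots> = - M\<^sup>2" by (simp add: M_def algebra_simps)
    finally show ?thesis using zero_le_power2[of M] by linarith
  qed
  then obtain r where r: "r \<le> 0" "?p r = 0"
    using IVT'[of ?p "- M" 0 0] \<open>?p (- M) \<le> 0\<close> p0 M cont by auto
  \<comment> \<open>Equal roots of opposite weak signs would both be 0, which \<open>p0\<close>
    excludes.\<close>
  have ne: "y - r \<noteq> 0" using y r p0 by auto
  \<comment> \<open>The third root by Vieta, since the roots sum to \<open>a\<close>.\<close>
  define w where "w = a - y - r"
  have "(y - r) * (y\<^sup>2 + y * r + r\<^sup>2 - a * (y + r) - b) = ?p y - ?p r"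
    by (simp add: hawkes_poly_eval algebra_simps power2_eq_square power3_eq_cube)
  then have b: "b = y\<^sup>2 + y * r + r\<^sup>2 - a * (y + r)"
    using y r ne by simp
  have "c = y ^ 3 - a * y\<^sup>2 - b * y" using y by (simp add: hawkes_poly_eval)
  then have c': "c = y * r * w"
    unfolding b w_def by (simp add: algebra_simps power2_eq_square power3_eq_cube)
  have "hawkes_poly a b c = [:- y, 1:] * [:- r, 1:] * [:- w, 1:]"
    unfolding hawkes_poly_def c' by (simp add: b w_def algebra_simps power2_eq_square)
  then have "cubic_disc (hawkes_poly a b c) = ((y - r) * (r - w) * (y - w))\<^sup>2"
    by (simp only: cubic_disc_roots)
  then show False using disc zero_le_power2 by (metis not_less)
qed

section \<open>Nilpotence on the nonnegative cone\<close>

definition hawkes_map :: "real \<Rightarrow> real \<Rightarrow> real \<Rightarrow> real \<times> real \<times> real \<Rightarrow> real \<times> real \<times> real" where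
  "hawkes_map a b c = (\<lambda>(i, j, k). (max 0 (a * i + b * j + c * k), i, j))"

text \<open>Ratio bounds are written as products to allow zero entries. For
  \<open>\<kappa> = 0\<close> only the states \<open>(0, 0, k)\<close> with \<open>k \<ge> 0\<close>
  remain.\<close>

definition ratio_cone :: "real \<Rightarrow> (real \<times> real \<times> real) set" where
  "ratio_cone \<kappa> = {(i, j, k). 0 \<le> i \<and> 0 \<le> j \<and> 0 \<le> k \<and> i \<le> \<kappa> * j \<and> j \<le> \<kappa> * k}"

text \<open>With \<open>j \<ge> i / \<kappa>\<close> and \<open>k \<ge> i / \<kappa>\<^sup>2\<close> the linear form is at most
  \<open>(a + b / \<kappa> + c / \<kappa>\<^sup>2) * i\<close>; multiplying by \<open>\<kappa>\<^sup>2\<close> avoids the divisions.\<close>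

lemma max_linear_le:
  assumes bc: "b < 0" "c < 0" and \<kappa>: "\<kappa> \<ge> 0" "\<kappa> > 0 \<Longrightarrow> \<epsilon> * \<kappa>\<^sup>2 \<le> poly (hawkes_poly a b c) \<kappa>"
    and x: "(i, j, k) \<in> ratio_cone \<kappa>"
  shows "max 0 (a * i + b * j + c * k) \<le> max 0 (\<kappa> - \<epsilon>) * i"
proof (cases "\<kappa> = 0")
  case True
  then show ?thesis using x bc by (auto simp: ratio_cone_def mult_nonpos_nonneg)
next
  case False
  then have pos: "\<kappa> > 0" using \<kappa> by simp
  have ij: "0 \<le> i" "i \<le> \<kappa> * j" "\<kappa> * j \<le> \<kappa> * (\<kappa> * k)"
    using x pos by (auto simp: ratio_cone_def)
  have "\<kappa>\<^sup>2 * (a * i + b * j + c * k) = a * \<kappa>\<^sup>2 * i + b * \<kappa> * (\<kappa> * j) + c * (\<kappa> * (\<kappa> * k))"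
    by (simp add: algebra_simps power2_eq_square)
  also have "\<dots> \<le> a * \<kappa>\<^sup>2 * i + b * \<kappa> * i + c * i"
  proof -
    have "b * \<kappa> * (\<kappa> * j) \<le> b * \<kappa> * i"
      using ij bc pos by (intro mult_left_mono_neg) (auto simp: mult_nonpos_nonneg)
    moreover have "c * (\<kappa> * (\<kappa> * k)) \<le> c * i" using ij bc by (intro mult_left_mono_neg) auto
    ultimately show ?thesis by simp
  qed
  also have "\<dots> = \<kappa>\<^sup>2 * (\<kappa> * i) - poly (hawkes_poly a b c) \<kappa> * i"
    by (simp add: hawkes_poly_eval algebra_simps power2_eq_square power3_eq_cube)
  also have "\<dots> \<le> \<kappa>\<^sup>2 * (\<kappa> * i) - \<epsilon> * \<kappa>\<^sup>2 * i"
    using \<kappa>(2)[OF pos] ij by (intro diff_left_mono mult_right_mono)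
  also have "\<dots> = \<kappa>\<^sup>2 * ((\<kappa> - \<epsilon>) * i)" by (simp add: algebra_simps)
  finally have "a * i + b * j + c * k \<le> (\<kappa> - \<epsilon>) * i" using pos by simp
  also have "\<dots> \<le> max 0 (\<kappa> - \<epsilon>) * i" using ij by (intro mult_right_mono) auto
  finally show ?thesis using ij by simp
qed

text \<open>Two applications are needed because the cone bounds two ratios: the first improves the
  leading one and stays in the old cone, the second improves the next, while the first moves into
  second place.\<close>

lemma ratio_cone_step:
  assumes bc: "b < 0" "c < 0" and \<kappa>: "\<kappa> \<ge> 0" "\<kappa> > 0 \<Longrightarrow> \<epsilon> * \<kappa>\<^sup>2 \<le> poly (hawkes_poly a b c) \<kappa>"
    and \<epsilon>: "\<epsilon> \<ge> 0" and x: "x \<in> ratio_cone \<kappa>"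
  shows "hawkes_map a b c (hawkes_map a b c x) \<in> ratio_cone (max 0 (\<kappa> - \<epsilon>))"
proof -
  obtain i j k where x': "x = (i, j, k)" by (cases x)
  define i' where "i' = max 0 (a * i + b * j + c * k)"
  define i'' where "i'' = max 0 (a * i' + b * i + c * j)"
  have 1: "i' \<le> max 0 (\<kappa> - \<epsilon>) * i"
    unfolding i'_def using max_linear_le[OF bc \<kappa>] x x' by simp
  also have "\<dots> \<le> \<kappa> * i"
    using \<kappa>(1) \<epsilon> x x' by (intro mult_right_mono) (auto simp: ratio_cone_def)
  finally have "(i', i, j) \<in> ratio_cone \<kappa>"
    using x x' by (auto simp: ratio_cone_def i'_def)
  from max_linear_le[OF bc \<kappa>(1) _ this] have "i'' \<le> max 0 (\<kappa> - \<epsilon>) * i'"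
    unfolding i''_def using \<kappa>(2) by blast
  then show ?thesis using 1 x
    by (simp add: x' hawkes_map_def ratio_cone_def i'_def i''_def)
qed

text \<open>On the compact range of possible ratio bounds the drop \<open>\<epsilon>\<close> is
  uniform, so the bound reaches 0 after finitely many steps.\<close>

lemma hawkes_map_nilpotent:
  assumes bc: "b < 0" "c < 0" and pos: "\<And>x. x \<ge> 0 \<Longrightarrow> poly (hawkes_poly a b c) x > 0"
  obtains m where "m > 0"
    "\<And>i j k. i \<ge> 0 \<Longrightarrow> j \<ge> 0 \<Longrightarrow> k \<ge> 0 \<Longrightarrow> (hawkes_map a b c ^^ m) (i, j, k) = (0, 0, 0)"
proof -
  let ?p = "poly (hawkes_poly a b c)" and ?T = "hawkes_map a b c"
  \<comment> \<open>A crude ratio bound, valid after any step because \<open>b\<close> and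
    \<open>c\<close> are negative; the maximum with 1 allows division by
    \<open>K\<^sup>2\<close>.\<close>
  define K where "K = max 1 a"
  have K: "K \<ge> 1" "a \<le> K" by (auto simp: K_def)
  have "\<exists>x\<in>{0..K}. \<forall>y\<in>{0..K}. ?p x \<le> ?p y"
    using K by (intro continuous_attains_inf) (auto intro: continuous_intros)
  then obtain x\<^sub>0 where x\<^sub>0: "x\<^sub>0 \<in> {0..K}" "\<And>y. y \<in> {0..K} \<Longrightarrow> ?p x\<^sub>0 \<le> ?p y" by blast
  \<comment> \<open>The minimum of the polynomial over \<open>{0..K}\<close>, scaled so that
    \<open>\<epsilon> * \<kappa>\<^sup>2\<close> stays below it on the whole interval.\<close>
  define \<epsilon> where "\<epsilon> = ?p x\<^sub>0 / K\<^sup>2"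
  have \<epsilon>: "\<epsilon> > 0" using pos[of x\<^sub>0] x\<^sub>0 K by (simp add: \<epsilon>_def)
  have step: "\<epsilon> * \<kappa>\<^sup>2 \<le> ?p \<kappa>" if "0 \<le> \<kappa>" "\<kappa> \<le> K" for \<kappa>
  proof -
    have "\<epsilon> * \<kappa>\<^sup>2 \<le> \<epsilon> * K\<^sup>2" using that \<epsilon> by (intro mult_left_mono power_mono) auto
    also have "\<dots> = ?p x\<^sub>0" using K by (simp add: \<epsilon>_def)
    also have "\<dots> \<le> ?p \<kappa>" using x\<^sub>0 that by simp
    finally show ?thesis .
  qed
  obtain q :: nat where q: "K / \<epsilon> \<le> real q" using real_arch_simple by blast
  \<comment> \<open>Two steps enter the cone with bound \<open>K\<close>, \<open>2 * q\<close> steps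
    shrink the bound to 0, and one more removes the last entry \<open>l\<close>, as
    \<open>c * l \<le> 0\<close>.\<close>
  have "(?T ^^ (3 + 2 * q)) (i, j, k) = (0, 0, 0)" if "i \<ge> 0" "j \<ge> 0" "k \<ge> 0" for i j k
  proof -
    have first: "max 0 (a * u + b * v + c * w) \<le> K * u" if "u \<ge> 0" "v \<ge> 0" "w \<ge> 0" for u v w
    proof -
      have "a * u + b * v + c * w \<le> K * u + 0 + 0"
        using that K bc by (intro add_mono mult_right_mono) (auto simp: mult_nonpos_nonneg)
      then show ?thesis using that K by simp
    qed
    have "(?T ^^ (2 + 2 * n)) (i, j, k) \<in> ratio_cone (max 0 (K - real n * \<epsilon>))" for n
    proof (induction n)
      case 0
      then show ?case using that first K
        by (simp add: numeral_2_eq_2 hawkes_map_def ratio_cone_def)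
    next
      case (Suc n)
      have "?T (?T ((?T ^^ (2 + 2 * n)) (i, j, k)))
          \<in> ratio_cone (max 0 (max 0 (K - real n * \<epsilon>) - \<epsilon>))"
      proof (rule ratio_cone_step[OF bc _ _ _ Suc])
        show "\<epsilon> * (max 0 (K - real n * \<epsilon>))\<^sup>2 \<le> ?p (max 0 (K - real n * \<epsilon>))"
          using \<epsilon> K by (intro step) auto
      qed (use \<epsilon> in auto)
      also have "max 0 (max 0 (K - real n * \<epsilon>) - \<epsilon>) = max 0 (K - real (Suc n) * \<epsilon>)"
        using \<epsilon> by (auto simp: max_def algebra_simps)
      finally show ?case by simp
    qed
    from this[of q] have "(?T ^^ (2 + 2 * q)) (i, j, k) \<in> ratio_cone 0"
      using q \<epsilon> by (simp add: field_simps max_def split: if_splits)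
    then obtain l where "l \<ge> 0" "(?T ^^ (2 + 2 * q)) (i, j, k) = (0, 0, l)"
      by (auto simp: ratio_cone_def)
    moreover have "(?T ^^ (3 + 2 * q)) (i, j, k) = ?T ((?T ^^ (2 + 2 * q)) (i, j, k))"
      by (simp add: numeral_3_eq_3)
    ultimately show ?thesis
      using bc by (simp add: hawkes_map_def mult_nonpos_nonneg)
  qed
  then show ?thesis by (intro that[of "3 + 2 * q"]) auto
qed

section \<open>A Lyapunov function built from orbits\<close>

definition norm1 :: "real \<times> real \<times> real \<Rightarrow> real" where
  "norm1 = (\<lambda>(i, j, k). \<bar>i\<bar> + \<bar>j\<bar> + \<bar>k\<bar>)"

lemma norm1_nonneg: "norm1 x \<ge> 0"
  by (simp add: norm1_def split: prod.split)

lemma norm1_le_add_diff: "norm1 x \<le> norm1 y + norm1 (x - y)"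
  by (cases x; cases y) (simp add: norm1_def)

text \<open>The map \<open>max 0\<close> is 1-Lipschitz; the summand 1 accounts for the two shifted
  coordinates.\<close>

lemma hawkes_map_lipschitz:
  "norm1 (hawkes_map a b c x - hawkes_map a b c y) \<le> (1 + \<bar>a\<bar> + \<bar>b\<bar> + \<bar>c\<bar>) * norm1 (x - y)"
proof -
  obtain i j k i' j' k' where x: "x = (i, j, k)" and y: "y = (i', j', k')" by (cases x; cases y)
  define S where "S = \<bar>i - i'\<bar> + \<bar>j - j'\<bar> + \<bar>k - k'\<bar>"
  have "\<bar>max 0 (a * i + b * j + c * k) - max 0 (a * i' + b * j' + c * k')\<bar>
      \<le> \<bar>a * (i - i') + b * (j - j') + c * (k - k')\<bar>"
    by (simp add: algebra_simps max_def)
  also have "\<dots> \<le> \<bar>a\<bar> * \<bar>i - i'\<bar> + \<bar>b\<bar> * \<bar>j - j'\<bar> + \<bar>c\<bar> * \<bar>k - k'\<bar>"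
    unfolding abs_mult[symmetric] by linarith
  also have "\<dots> \<le> \<bar>a\<bar> * S + \<bar>b\<bar> * S + \<bar>c\<bar> * S"
    by (intro add_mono mult_left_mono) (auto simp: S_def)
  finally have "\<bar>max 0 (a * i + b * j + c * k) - max 0 (a * i' + b * j' + c * k')\<bar>
      \<le> \<bar>a\<bar> * S + \<bar>b\<bar> * S + \<bar>c\<bar> * S" .
  moreover have "\<bar>i - i'\<bar> + \<bar>j - j'\<bar> \<le> S" by (simp add: S_def)
  moreover have "norm1 (x - y) = S" by (simp add: norm1_def x y S_def)
  ultimately show ?thesis by (simp add: norm1_def hawkes_map_def x y distrib_right)
qed

text \<open>An adapted norm: the factor 2 per step turns the index shift caused by the map into a
  halving.\<close>

definition orbit_weight :: "real \<Rightarrow> real \<Rightarrow> real \<Rightarrow> nat \<Rightarrow> real \<times> real \<times> real \<Rightarrow> real" where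
  "orbit_weight a b c m x = (\<Sum>n<m. 2 ^ n * norm1 ((hawkes_map a b c ^^ n) x))"

lemma orbit_weight_lipschitz:
  "orbit_weight a b c m x
     \<le> orbit_weight a b c m y + (\<Sum>n<m. 2 ^ n * (1 + \<bar>a\<bar> + \<bar>b\<bar> + \<bar>c\<bar>) ^ n) * norm1 (x - y)"
proof -
  let ?T = "hawkes_map a b c" and ?L = "1 + \<bar>a\<bar> + \<bar>b\<bar> + \<bar>c\<bar>"
  have L: "norm1 ((?T ^^ n) x - (?T ^^ n) y) \<le> ?L ^ n * norm1 (x - y)" for n
  proof (induction n)
    case (Suc n)
    have "norm1 ((?T ^^ Suc n) x - (?T ^^ Suc n) y) \<le> ?L * norm1 ((?T ^^ n) x - (?T ^^ n) y)"
      using hawkes_map_lipschitz by simp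
    also have "\<dots> \<le> ?L * (?L ^ n * norm1 (x - y))" by (intro mult_left_mono Suc) auto
    finally show ?case by (simp only: power_Suc mult.assoc)
  qed simp
  have "norm1 ((?T ^^ n) x) \<le> norm1 ((?T ^^ n) y) + ?L ^ n * norm1 (x - y)" for n
    using norm1_le_add_diff[of "(?T ^^ n) x" "(?T ^^ n) y"] L[of n] by linarith
  then have "orbit_weight a b c m x
      \<le> (\<Sum>n<m. 2 ^ n * (norm1 ((?T ^^ n) y) + ?L ^ n * norm1 (x - y)))"
    unfolding orbit_weight_def
    by (intro sum_mono mult_left_mono) auto
  also have "\<dots> = orbit_weight a b c m y + (\<Sum>n<m. 2 ^ n * ?L ^ n) * norm1 (x - y)"
    by (simp only: orbit_weight_def distrib_left sum.distrib sum_distrib_right mult.assoc)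
  finally show ?thesis .
qed

lemma orbit_weight_nonneg: "orbit_weight a b c m x \<ge> 0"
  unfolding orbit_weight_def by (intro sum_nonneg mult_nonneg_nonneg norm1_nonneg) auto

text \<open>The summand for \<open>n = 0\<close>. It makes sublevel sets of the weight bounded and
  controls the Poisson rate by the weight.\<close>

lemma norm1_le_orbit_weight: "m > 0 \<Longrightarrow> norm1 x \<le> orbit_weight a b c m x"
  unfolding orbit_weight_def
  using member_le_sum[of 0 "{..<m}" "\<lambda>n. 2 ^ n * norm1 ((hawkes_map a b c ^^ n) x)"]
  by (simp add: norm1_nonneg)

text \<open>After the index shift the new last summand, at \<open>m\<close>, vanishes by
  nilpotence.\<close>

lemma orbit_weight_map:
  assumes "(hawkes_map a b c ^^ m) x = (0, 0, 0)"
  shows "2 * orbit_weight a b c m (hawkes_map a b c x) \<le> orbit_weight a b c m x"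
proof -
  let ?f = "\<lambda>n. 2 ^ n * norm1 ((hawkes_map a b c ^^ n) x)"
  have "2 * orbit_weight a b c m (hawkes_map a b c x) = (\<Sum>n<m. ?f (Suc n))"
    by (simp add: orbit_weight_def sum_distrib_left mult.assoc funpow_swap1)
  also have "\<dots> \<le> (\<Sum>n<Suc m. ?f n)"
    unfolding sum.lessThan_Suc_shift using norm1_nonneg[of x] by simp
  also have "\<dots> = orbit_weight a b c m x"
    using assms by (simp add: orbit_weight_def norm1_def)
  finally show ?thesis .
qed

section \<open>The Hawkes chain\<close>

text \<open>The first two factorial moments come from shifting the exponential series by
  \<open>shift\<close>; the rate 0 is covered through \<open>0 ^ 0 = 1\<close>.\<close>

lemma poisson0_variance:
  assumes s: "s \<ge> 0"
  shows "(\<integral>\<^sup>+ l. ennreal ((real l - s)\<^sup>2) \<partial>poisson0_pmf s) = ennreal s"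
proof -
  define w where "w l = s ^ l / fact l" for l
  have w0: "w sums exp s"
    using exp_converges[of s] by (simp add: w_def[abs_def] field_simps scaleR_conv_of_real)
  have shift: "real (Suc l) * w (Suc l) = s * w l" for l
    by (simp add: w_def del: of_nat_Suc)
  have w1: "(\<lambda>l. real l * w l) sums (s * exp s)"
    using sums_Suc_iff[of "\<lambda>l. real l * w l" "s * exp s"] sums_mult[OF w0, of s]
    by (simp add: shift del: of_nat_Suc)
  have "(\<lambda>l. real (Suc l) * real l * w (Suc l)) = (\<lambda>l. s * (real l * w l))"
    using shift by (auto simp: fun_eq_iff)
  then have w2: "(\<lambda>l. real l * (real l - 1) * w l) sums (s * (s * exp s))"
    using sums_Suc_iff[of "\<lambda>l. real l * (real l - 1) * w l" "s * (s * exp s)"] sums_mult[OF w1, of s]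
    by simp
  \<comment> \<open>Expands \<open>(real l - s)\<^sup>2\<close> as
    \<open>l * (l - 1) + (1 - 2 * s) * l + s\<^sup>2\<close>.\<close>
  have "(\<lambda>l. exp (- s) * (real l * (real l - 1) * w l + (1 - 2 * s) * (real l * w l) + s\<^sup>2 * w l))
      sums (exp (- s) * (s * (s * exp s) + (1 - 2 * s) * (s * exp s) + s\<^sup>2 * exp s))"
    by (intro sums_mult sums_add w0 w1 w2)
  also have "(\<lambda>l. exp (- s) * (real l * (real l - 1) * w l + (1 - 2 * s) * (real l * w l) + s\<^sup>2 * w l))
      = (\<lambda>l. pmf (poisson0_pmf s) l * (real l - s)\<^sup>2)"
    using s by (auto simp: fun_eq_iff pmf_poisson0 w_def field_simps power2_eq_square)
  also have "exp (- s) * (s * (s * exp s) + (1 - 2 * s) * (s * exp s) + s\<^sup>2 * exp s)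
      = s * (exp (- s) * exp s)"
    by (simp add: algebra_simps power2_eq_square)
  finally have "(\<lambda>l. pmf (poisson0_pmf s) l * (real l - s)\<^sup>2) sums s"
    by (simp flip: exp_add)
  then have "(\<Sum>l. ennreal (pmf (poisson0_pmf s) l * (real l - s)\<^sup>2)) = ennreal s"
    using s by (intro suminf_ennreal_eq) auto
  then show ?thesis
    by (simp add: nn_integral_measure_pmf nn_integral_count_space_nat ennreal_mult)
qed

text \<open>Only the paths through \<open>y\<close> are kept; chained, this bounds a multi-step
  transition below by the probability of one path.\<close>

lemma pmf_bind_ge: "pmf p y * pmf (f y) z \<le> pmf (bind_pmf p f) z"
proof -
  have "ennreal (pmf p y * pmf (f y) z) = (\<integral>\<^sup>+ u. ennreal (pmf (f y) z) * indicator {y} u \<partial>p)"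
    by (subst nn_integral_cmult_indicator) (auto simp: emeasure_pmf_single ennreal_mult mult.commute)
  also have "\<dots> \<le> (\<integral>\<^sup>+ u. pmf (f u) z \<partial>p)"
    by (intro nn_integral_mono) (auto simp: indicator_def)
  also have "\<dots> = ennreal (pmf (bind_pmf p f) z)" by (simp add: ennreal_pmf_bind)
  finally show ?thesis by simp
qed

text \<open>Follows the path of three consecutive zeros. As \<open>b\<close> and \<open>c\<close>
  are negative, its first rate is at most \<open>\<bar>a\<bar> * real i + lam\<close> and the other
  two, with leading entry 0, at most \<open>lam\<close>.\<close>

lemma hawkes_chain_reach_zero:
  assumes bc: "b < 0" "c < 0" and lam: "lam > 0"
  shows "exp (- (\<bar>a\<bar> * real i + 3 * lam)) \<le> pmf (chain_law (hawkes_kernel a b c lam) (i, j, k) 3) (0, 0, 0)"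
proof -
  let ?K = "hawkes_kernel a b c lam" and ?s = "hawkes_rate a b c lam"
  have zero: "pmf (?K (i, j, k)) (0, i, j) = exp (- ?s (i, j, k))" for i j k
    by (simp add: pmf_hawkes_kernel)
  have rate: "?s (i, j, k) \<le> \<bar>a\<bar> * real i + lam" for i j k
  proof -
    have "a * real i + b * real j + c * real k + lam \<le> \<bar>a\<bar> * real i + 0 + 0 + lam"
      using bc by (intro add_mono mult_right_mono) (auto simp: mult_nonpos_nonneg)
    then show ?thesis using lam by (simp add: hawkes_rate_def)
  qed
  have "exp (- (\<bar>a\<bar> * real i + 3 * lam)) \<le> exp (- (?s (i, j, k) + ?s (0, i, j) + ?s (0, 0, i)))"
    using rate[of i j k] rate[of 0 i j] rate[of 0 0 i] by simp
  also have "\<dots> = pmf (?K (i, j, k)) (0, i, j) * pmf (?K (0, i, j)) (0, 0, i) * pmf (?K (0, 0, i)) (0, 0, 0)"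
    by (simp add: zero exp_add[symmetric])
  also have "\<dots> \<le> pmf (bind_pmf (?K (i, j, k)) ?K) (0, 0, i) * pmf (?K (0, 0, i)) (0, 0, 0)"
    by (intro mult_right_mono pmf_bind_ge) auto
  also have "\<dots> \<le> pmf (bind_pmf (bind_pmf (?K (i, j, k)) ?K) ?K) (0, 0, 0)"
    by (rule pmf_bind_ge)
  finally show ?thesis by (simp add: numeral_3_eq_3 bind_return_pmf)
qed

section \<open>The drift condition\<close>

text \<open>The noiseless image contributes at most half of \<open>V\<close>, and the noise is tuned
  to cost at most another quarter plus a constant, whence \<open>3 / 4\<close>.\<close>

lemma hawkes_drift:
  fixes a b c lam :: real
  assumes bc: "b < 0" "c < 0" and lam: "lam > 0" and m: "m > 0"
    and nil: "\<And>i j k. i \<ge> 0 \<Longrightarrow> j \<ge> 0 \<Longrightarrow> k \<ge> 0 \<Longrightarrow> (hawkes_map a b c ^^ m) (i, j, k) = (0, 0, 0)"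
  defines "V \<equiv> \<lambda>(i, j, k). orbit_weight a b c m (real i, real j, real k)"
  shows "\<exists>B\<ge>0. \<forall>x. (\<integral>\<^sup>+ y. V y \<partial>hawkes_kernel a b c lam x) \<le> ennreal (3 / 4 * V x + B)"
proof -
  let ?W = "orbit_weight a b c m"
  define C where "C = (\<Sum>n<m. 2 ^ n * (1 + \<bar>a\<bar> + \<bar>b\<bar> + \<bar>c\<bar>) ^ n)"
  have C: "C \<ge> 0" unfolding C_def by (intro sum_nonneg) auto
  \<comment> \<open>The \<open>+ 1\<close> keeps the denominator positive even when
    \<open>C * \<bar>a\<bar>\<close> is 0.\<close>
  define \<eta> where "\<eta> = 1 / (4 * (C * \<bar>a\<bar> + 1))"
  have \<eta>: "\<eta> > 0" "C * \<eta> * \<bar>a\<bar> \<le> 1 / 4" using C by (auto simp: \<eta>_def field_simps add_pos_nonneg)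
  \<comment> \<open>The three summands come from replacing \<open>t\<close> by \<open>s\<close>,
    from AM-GM, and from the \<open>lam\<close> in the bound on the variance
    \<open>s\<close>.\<close>
  define B where "B = C * (lam + 1 / (4 * \<eta>) + \<eta> * lam)"
  have B: "B \<ge> 0" using C \<eta> lam by (simp add: B_def)
  have "(\<integral>\<^sup>+ y. V y \<partial>hawkes_kernel a b c lam (i, j, k)) \<le> ennreal (3 / 4 * V (i, j, k) + B)" for i j k
  proof -
    define s where "s = hawkes_rate a b c lam (i, j, k)"
    define x where "x = (real i, real j, real k)"
    \<comment> \<open>The first entry of the noiseless image of \<open>x\<close>; only
      \<open>lam\<close> separates it from the true rate \<open>s\<close>.\<close>
    define t where "t = max 0 (a * real i + b * real j + c * real k)"
    have s0: "s \<ge> 0" by (simp add: s_def hawkes_rate_def)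
    have st: "\<bar>s - t\<bar> \<le> lam" using lam by (simp add: s_def t_def hawkes_rate_def)
    have "norm1 x \<le> ?W x" by (rule norm1_le_orbit_weight[OF m])
    then have i: "real i \<le> ?W x" by (simp add: x_def norm1_def)
    have "a * real i + b * real j + c * real k + lam \<le> \<bar>a\<bar> * real i + 0 + 0 + lam"
      using bc by (intro add_mono mult_right_mono) (auto simp: mult_nonpos_nonneg)
    also have "\<dots> \<le> \<bar>a\<bar> * ?W x + lam" using i by (simp add: mult_left_mono)
    finally have s: "s \<le> \<bar>a\<bar> * ?W x + lam"
      using lam orbit_weight_nonneg[of a b c m x] by (simp add: s_def hawkes_rate_def)
    have T: "2 * ?W (hawkes_map a b c x) \<le> ?W x"
      by (rule orbit_weight_map) (simp add: x_def nil)
    have pt: "V (l, i, j) \<le> (?W x / 2 + C * (lam + 1 / (4 * \<eta>))) + C * \<eta> * (real l - s)\<^sup>2" for l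
    proof -
      \<comment> \<open>AM-GM trades the mean deviation for the variance \<open>s\<close> with the small factor \<open>\<eta>\<close>.\<close>
      have "0 \<le> (2 * \<eta> * \<bar>real l - s\<bar> - 1)\<^sup>2" by simp
      then have "4 * \<eta> * \<bar>real l - s\<bar> \<le> 4 * \<eta> * (\<eta> * (real l - s)\<^sup>2) + 1"
        by (simp add: power2_diff power_mult_distrib) (simp add: power2_eq_square algebra_simps)
      then have "\<bar>real l - s\<bar> \<le> \<eta> * (real l - s)\<^sup>2 + 1 / (4 * \<eta>)"
        using \<eta> by (simp add: field_simps)
      then have "\<bar>real l - t\<bar> \<le> lam + (\<eta> * (real l - s)\<^sup>2 + 1 / (4 * \<eta>))" using st by linarith
      then have "C * \<bar>real l - t\<bar> \<le> C * (lam + (\<eta> * (real l - s)\<^sup>2 + 1 / (4 * \<eta>)))"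
        using C by (rule mult_left_mono)
      \<comment> \<open>The new state and the noiseless image differ in the first entry only, so the
        Lipschitz bound sees just \<open>\<bar>real l - t\<bar>\<close>.\<close>
      moreover have "V (l, i, j) \<le> ?W (hawkes_map a b c x) + C * \<bar>real l - t\<bar>"
        using orbit_weight_lipschitz[of a b c m "(real l, real i, real j)" "hawkes_map a b c x"]
        by (simp add: V_def C_def x_def hawkes_map_def t_def norm1_def zero_prod_def)
      ultimately show ?thesis using T by (simp add: algebra_simps)
    qed
    have "(\<integral>\<^sup>+ y. V y \<partial>hawkes_kernel a b c lam (i, j, k)) = (\<integral>\<^sup>+ l. V (l, i, j) \<partial>poisson0_pmf s)"
      by (simp add: hawkes_kernel_def s_def)
    also have "\<dots> \<le> (\<integral>\<^sup>+ l. ennreal (?W x / 2 + C * (lam + 1 / (4 * \<eta>)))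
        + ennreal (C * \<eta>) * ennreal ((real l - s)\<^sup>2) \<partial>poisson0_pmf s)"
      using C \<eta> lam orbit_weight_nonneg[of a b c m x] pt
      by (intro nn_integral_mono) (simp add: ennreal_leI flip: ennreal_mult ennreal_plus)
    also have "\<dots> = ennreal (?W x / 2 + C * (lam + 1 / (4 * \<eta>))) + ennreal (C * \<eta>) * ennreal s"
      by (simp add: nn_integral_add nn_integral_cmult measure_pmf.emeasure_space_1 poisson0_variance[OF s0])
    also have "\<dots> = ennreal (?W x / 2 + C * (lam + 1 / (4 * \<eta>)) + C * \<eta> * s)"
      using C \<eta> lam orbit_weight_nonneg[of a b c m x] s0
      by (simp flip: ennreal_mult ennreal_plus)
    also have "\<dots> \<le> ennreal (3 / 4 * V (i, j, k) + B)"
    proof (rule ennreal_leI)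
      have "C * \<eta> * s \<le> C * \<eta> * (\<bar>a\<bar> * ?W x + lam)" using C \<eta> s by (intro mult_left_mono) auto
      moreover have "(C * \<eta> * \<bar>a\<bar>) * ?W x \<le> 1 / 4 * ?W x"
        using \<eta> by (intro mult_right_mono orbit_weight_nonneg)
      ultimately show "?W x / 2 + C * (lam + 1 / (4 * \<eta>)) + C * \<eta> * s \<le> 3 / 4 * V (i, j, k) + B"
        by (simp add: V_def B_def x_def algebra_simps)
    qed
    finally show ?thesis .
  qed
  then show ?thesis using B by (intro exI[of _ B]) auto
qed

theorem theorem2p2:
  fixes a b c lam :: real
  assumes "lam > 0"
    and "b < 0" and "c < 0"
    and "cubic_disc (hawkes_poly a b c) < 0"
  shows "geometrically_ergodic (hawkes_kernel a b c lam)"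
proof -
  obtain m where m: "m > 0"
    "\<And>i j k. i \<ge> 0 \<Longrightarrow> j \<ge> 0 \<Longrightarrow> k \<ge> 0 \<Longrightarrow> (hawkes_map a b c ^^ m) (i, j, k) = (0, 0, 0)"
    using hawkes_map_nilpotent[OF assms(2,3) hawkes_poly_pos[OF assms(3,4)]] by blast
  define V :: "nat \<times> nat \<times> nat \<Rightarrow> real"
    where "V = (\<lambda>(i, j, k). orbit_weight a b c m (real i, real j, real k))"
  obtain B where B: "B \<ge> 0"
    "\<And>x. (\<integral>\<^sup>+ y. V y \<partial>hawkes_kernel a b c lam x) \<le> ennreal (3 / 4 * V x + B)"
    using hawkes_drift[OF assms(2,3,1) m] unfolding V_def by blast
  show ?thesis
  \<comment> \<open>Three steps replace all three remembered values, hence \<open>N = 3\<close> and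
    the zero state as meeting point.\<close>
  proof (rule harris[OF _ _ _ B(1) _ B(2), where N = 3 and z\<^sub>0 = "(0, 0, 0)"])
    fix R :: real
    have "exp (- (\<bar>a\<bar> * R + 3 * lam)) \<le> pmf (chain_law (hawkes_kernel a b c lam) x 3) (0, 0, 0)"
      if "V x \<le> R" for x
    proof -
      obtain i j k where x: "x = (i, j, k)" by (cases x)
      have "norm1 (real i, real j, real k) \<le> R"
        using norm1_le_orbit_weight[OF m(1), of "(real i, real j, real k)" a b c] that
        by (simp add: V_def x)
      then have "\<bar>a\<bar> * real i \<le> \<bar>a\<bar> * R" by (intro mult_left_mono) (auto simp: norm1_def)
      then have "exp (- (\<bar>a\<bar> * R + 3 * lam)) \<le> exp (- (\<bar>a\<bar> * real i + 3 * lam))" by simp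
      also have "\<dots> \<le> pmf (chain_law (hawkes_kernel a b c lam) x 3) (0, 0, 0)"
        unfolding x by (rule hawkes_chain_reach_zero[OF assms(2,3,1)])
      finally show ?thesis .
    qed
    then show "\<exists>\<alpha>>0. \<forall>x. V x \<le> R \<longrightarrow> \<alpha> \<le> pmf (chain_law (hawkes_kernel a b c lam) x 3) (0, 0, 0)"
      by (intro exI[of _ "exp (- (\<bar>a\<bar> * R + 3 * lam))"]) auto
  qed (auto simp: V_def orbit_weight_nonneg split: prod.split)
qed

end
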